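(* Let $D\subset\mathbb{R}$ be an open interval and let $f:D\to\mathbb{R}$ be an eight times continuously differentiable function with a simple zero $x^{\ast}\in D$ (that is, $f(x^{\ast})=0$ and $f'(x^{\ast})\neq 0$). For an initial point $x_0$, consider the iteration, for $n=0,1,2,\dots$, $$u_n := \frac{f(x_n)}{f'(x_n)},\qquad y_n := x_n-u_n,$$ $$z_n := x_n-u_n\left(1+\frac{f(y_n)}{f(x_n)}+\left(1+\frac{1}{1+u_n}\right)\left(\frac{f(y_n)}{f(x_n)}\right)^2\right),$$ $$x_{n+1} := z_n-\frac{f(z_n)}{f[z_n,y_n]+(z_n-y_n)\,f[z_n,y_n,x_n]+(z_n-y_n)(z_n-x_n)\,f[z_n,y_n,x_n,x_n]}.$$ If the initial point $x_0$ is sufficiently close to $x^{\ast}$, then the sequence $(x_n)$ defined by this iteration converges to $x^{\ast}$ with order eight.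
   Context: Divided differences are defined by $f[t]=f(t)$, $f[t,t]=f'(t)$, and recursively $$f[t_\nu,t_{\nu+1},\dots,t_{\nu+j}]=\frac{f[t_{\nu+1},\dots,t_{\nu+j}]-f[t_\nu,\dots,t_{\nu+j-1}]}{t_{\nu+j}-t_\nu}.$$ "Sufficiently close" means that there is $\delta>0$ (depending on $f$ and $x^{\ast}$) such that the assertion holds for every $x_0$ with $|x_0-x^{\ast}|<\delta$. If $x_n=x^{\ast}$ for some $n$, the iteration is regarded as having terminated at the root (put $x_m=x^{\ast}$ for all $m\ge n$). Convergence "with order eight" means that $x_n\to x^{\ast}$ and there is a constant $C\geq 0$ with $|x_{n+1}-x^{\ast}|\le C\,|x_n-x^{\ast}|^8$ for all $n$. The coefficient of $(x_n-x^{\ast})^8$ in the expansion of $x_{n+1}-x^{\ast}$ depends on $f$ and is allowed to vanish for particular $f$, in which case convergence is faster. *)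

theory Defs
  imports "HOL-Analysis.Analysis"
begin

text \<open>Functions on \<open>D\<close> are represented by total functions \<open>real \<Rightarrow> real\<close>. The set \<open>D\<close> is always
  open below, so \<open>deriv\<close> and its iterates at points of \<open>D\<close> depend only on the values on \<open>D\<close>.\<close>

definition times_cont_diff_on :: "nat \<Rightarrow> (real \<Rightarrow> real) \<Rightarrow> real set \<Rightarrow> bool" where
  "times_cont_diff_on k f D \<longleftrightarrow>
     (\<forall>j<k. \<forall>t\<in>D. (deriv ^^ j) f field_differentiable at t) \<and> continuous_on D ((deriv ^^ k) f)"

text \<open>The only confluent base case is \<open>f[t,t] = f'(t)\<close>; longer difference lists need distinct end
  points at every level of the recursion, which \<open>div_diff_defined\<close> records. The value for the
  empty list is arbitrary.\<close>

fun div_diff :: "(real \<Rightarrow> real) \<Rightarrow> real list \<Rightarrow> real" where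
  "div_diff f [] = 0"
| "div_diff f [t] = f t"
| "div_diff f (t # s # ts) =
     (if ts = [] \<and> s = t then deriv f t
      else (div_diff f (s # ts) - div_diff f (butlast (t # s # ts))) / (last (s # ts) - t))"

fun div_diff_defined :: "real list \<Rightarrow> bool" where
  "div_diff_defined [] \<longleftrightarrow> False"
| "div_diff_defined [t] \<longleftrightarrow> True"
| "div_diff_defined (t # s # ts) \<longleftrightarrow>
     (ts = [] \<and> s = t) \<or>
     (last (s # ts) \<noteq> t \<and> div_diff_defined (s # ts) \<and> div_diff_defined (butlast (t # s # ts)))"

definition newton_u :: "(real \<Rightarrow> real) \<Rightarrow> real \<Rightarrow> real" where
  "newton_u f x = f x / deriv f x"

definition newton_y :: "(real \<Rightarrow> real) \<Rightarrow> real \<Rightarrow> real" where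
  "newton_y f x = x - newton_u f x"

definition step_z :: "(real \<Rightarrow> real) \<Rightarrow> real \<Rightarrow> real" where
  "step_z f x = x - newton_u f x *
     (1 + f (newton_y f x) / f x
        + (1 + 1 / (1 + newton_u f x)) * (f (newton_y f x) / f x)\<^sup>2)"

definition slope_z :: "(real \<Rightarrow> real) \<Rightarrow> real \<Rightarrow> real" where
  "slope_z f x =
     (let y = newton_y f x; z = step_z f x
      in div_diff f [z, y] + (z - y) * div_diff f [z, y, x]
           + (z - y) * (z - x) * div_diff f [z, y, x, x])"

definition step_next :: "(real \<Rightarrow> real) \<Rightarrow> real \<Rightarrow> real" where
  "step_next f x = step_z f x - f (step_z f x) / slope_z f x"

text \<open>Division by zero yields \<open>0\<close> in HOL and \<open>f\<close> has values outside \<open>D\<close>, so \<open>step_next\<close> always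
  denotes a real number. The next predicate says that the step from \<open>x\<close> is meaningful: \<open>f\<close> is
  evaluated only inside \<open>D\<close> and no denominator vanishes.\<close>

definition step_defined :: "(real \<Rightarrow> real) \<Rightarrow> real set \<Rightarrow> real \<Rightarrow> bool" where
  "step_defined f D x \<longleftrightarrow>
     (let y = newton_y f x; z = step_z f x
      in x \<in> D \<and> y \<in> D \<and> z \<in> D \<and>
         deriv f x \<noteq> 0 \<and> f x \<noteq> 0 \<and> 1 + newton_u f x \<noteq> 0 \<and>
         div_diff_defined [z, y] \<and> div_diff_defined [z, y, x] \<and> div_diff_defined [z, y, x, x] \<and>
         slope_z f x \<noteq> 0)"

text \<open>The iteration from \<open>x0\<close>; it stays at the root \<open>r\<close> once \<open>r\<close> is reached.\<close>

primrec iter_seq :: "(real \<Rightarrow> real) \<Rightarrow> real \<Rightarrow> real \<Rightarrow> nat \<Rightarrow> real" where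
  "iter_seq f r x0 0 = x0"
| "iter_seq f r x0 (Suc n) = (if iter_seq f r x0 n = r then r else step_next f (iter_seq f r x0 n))"

definition converges_with_order :: "nat \<Rightarrow> (nat \<Rightarrow> real) \<Rightarrow> real \<Rightarrow> bool" where
  "converges_with_order p X L \<longleftrightarrow>
     X \<longlonglongrightarrow> L \<and> (\<exists>C\<ge>0. \<forall>n. \<bar>X (Suc n) - L\<bar> \<le> C * \<bar>X n - L\<bar> ^ p)"

end

theory Submission
  imports Defs "HOL-Library.Landau_Symbols"
begin

text \<open>Write \<open>e = x - r\<close>, and let \<open>y\<close>, \<open>z\<close>, \<open>x'\<close> be the two intermediate points and the result of
  one step from \<open>x\<close>. All errors are treated as functions of \<open>x\<close> that are \<open>O(e ^ k)\<close> as
  \<open>x \<longlongrightarrow> r\<close>; only upper bounds matter, never the exact asymptotic constants. With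
  \<open>f = c1 * s + c2 * s ^ 2 + c3 * s ^ 3 + O(s ^ 4)\<close> in powers of \<open>s = t - r\<close>, where \<open>c1 \<noteq> 0\<close>,
  the three stages have the following orders.

  \<^item> The Newton point has \<open>y - r = (c2 / c1) * e ^ 2 + O(e ^ 3)\<close>, so the ratio \<open>f y / f x\<close> is
    \<open>(c2 / c1) * e + O(e ^ 2)\<close> and \<open>c1 * (1 + 2 * (f y / f x))\<close> agrees with \<open>f' x\<close> up to
    \<open>O(e ^ 2)\<close> (lemma \<open>ratio_expansion\<close>).
  \<^item> The weight in the definition of \<open>z\<close> amounts to
    \<open>z = y - (f y / f' x) * (1 + 2 * (f y / f x) + O(e ^ 2))\<close>. By the previous point this is a Newton
    correction of \<open>y\<close> whose slope is right up to \<open>O(e ^ 2)\<close>. Since \<open>y - r\<close> is itself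
    \<open>O(e ^ 2)\<close>, it follows that \<open>z - r = O(e ^ 4)\<close> (lemma \<open>step_z_order\<close>).
  \<^item> The denominator of the last correction is the derivative at \<open>z\<close> of the cubic polynomial that
    interpolates \<open>f\<close> at \<open>z, y, x, x\<close>. It is therefore exact on cubics, and only the Taylor
    remainder of \<open>f\<close> contributes an error. By the mean value theorem a first divided difference of
    the remainder is \<open>O(h ^ 3)\<close> on points within \<open>h\<close> of \<open>r\<close>. Each further division costs one power
    of \<open>e\<close>, but the factors \<open>z - y = O(e ^ 2)\<close> and \<open>z - x = O(e)\<close> more than compensate. The
    denominator is thus \<open>c1 + O(e ^ 4)\<close> (lemma \<open>slope_z_order\<close>), and
    \<open>x' - r = O((z - r) * e ^ 4) + O((z - r) ^ 2) = O(e ^ 8)\<close> (lemma \<open>step_next_order\<close>).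

  The same expansions give the nonvanishing of every denominator near \<open>r\<close>. Finally, a map with
  \<open>\<bar>x' - r\<bar> \<le> C * \<bar>x - r\<bar> ^ 8\<close> near \<open>r\<close> at least halves the distance to \<open>r\<close> on a small enough
  interval, so the iteration stays there and converges (lemma \<open>iter_seq_converges_with_order\<close>).\<close>

section \<open>Functions vanishing to a given order\<close>

text \<open>Writing the order as a number lets products and quotients be handled by adding and subtracting
  orders.\<close>

definition vanish :: "real \<Rightarrow> nat \<Rightarrow> (real \<Rightarrow> real) \<Rightarrow> bool" where
  "vanish r k g \<longleftrightarrow> g \<in> O[at r](\<lambda>x. (x - r) ^ k)"

lemma vanish_add: "vanish r k g \<Longrightarrow> vanish r k h \<Longrightarrow> vanish r k (\<lambda>x. g x + h x)"
  unfolding vanish_def by (rule sum_in_bigo)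

lemma vanish_diff: "vanish r k g \<Longrightarrow> vanish r k h \<Longrightarrow> vanish r k (\<lambda>x. g x - h x)"
  unfolding vanish_def by (rule sum_in_bigo)

lemma vanish_mult: "vanish r k g \<Longrightarrow> vanish r l h \<Longrightarrow> vanish r (k + l) (\<lambda>x. g x * h x)"
  unfolding vanish_def power_add by (rule landau_o.big.mult)

lemma vanish_const: "vanish r 0 (\<lambda>_. c)"
  unfolding vanish_def by simp

lemma vanish_cmult: "vanish r k g \<Longrightarrow> vanish r k (\<lambda>x. c * g x)"
  using vanish_mult[OF vanish_const] by simp

lemma vanish_power: "vanish r k (\<lambda>x. (x - r) ^ k)"
  unfolding vanish_def by simp

lemma vanish_dist: "vanish r (Suc 0) (\<lambda>x. x - r)"
  using vanish_power[of r "Suc 0"] by simp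

lemma vanish_pow: "vanish r k g \<Longrightarrow> vanish r (n * k) (\<lambda>x. g x ^ n)"
proof (induction n)
  case 0
  show ?case using vanish_const by simp
next
  case (Suc n)
  then show ?case using vanish_mult[of r k g "n * k"] by simp
qed

lemma vanish_abs: "vanish r k g \<Longrightarrow> vanish r k (\<lambda>x. \<bar>g x\<bar>)"
  unfolding vanish_def by simp

lemma vanish_tendsto: "vanish r k g \<Longrightarrow> 0 < k \<Longrightarrow> (g \<longlongrightarrow> 0) (at r)"
proof -
  assume v: "vanish r k g" and k: "0 < k"
  obtain C where C: "\<forall>\<^sub>F x in at r. norm (g x) \<le> C * norm ((x - r) ^ k)"
    using v unfolding vanish_def by (auto elim: landau_o.bigE)
  have "((\<lambda>x. C * norm ((x - r) ^ k)) \<longlongrightarrow> C * norm ((r - r) ^ k)) (at r)"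
    by (intro tendsto_intros)
  then have "((\<lambda>x. C * norm ((x - r) ^ k)) \<longlongrightarrow> 0) (at r)"
    using k by (simp add: zero_power)
  then show ?thesis by (rule Lim_null_comparison[OF C])
qed

lemma vanish_mono:
  assumes "vanish r k g" "l \<le> k"
  shows "vanish r l g"
proof -
  obtain m where k: "k = l + m" using assms(2) le_Suc_ex by blast
  have "((\<lambda>x. (x - r) ^ m) \<longlongrightarrow> (r - r) ^ m) (at r)"
    by (intro tendsto_intros)
  then have "vanish r 0 (\<lambda>x. (x - r) ^ m)"
    unfolding vanish_def power_0 by (intro bigoI_tendsto[of _ _ "(r - r) ^ m"]) auto
  from vanish_mult[OF vanish_power[of r l] this]
  have "(\<lambda>x. (x - r) ^ k) \<in> O[at r](\<lambda>x. (x - r) ^ l)"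
    by (simp add: vanish_def k power_add)
  with assms(1) show ?thesis
    unfolding vanish_def by (rule landau_o.big_trans)
qed

lemma vanish_bound:
  assumes "vanish r k h" "\<forall>\<^sub>F x in at r. \<bar>g x\<bar> \<le> C * \<bar>h x\<bar>"
  shows "vanish r k g"
proof -
  have "g \<in> O[at r](h)" using assms(2) by (intro bigoI[of _ C]) auto
  then show ?thesis using assms(1) unfolding vanish_def by (rule landau_o.big_trans)
qed

lemma vanish_cong:
  assumes "vanish r k h" "\<forall>\<^sub>F x in at r. g x = h x"
  shows "vanish r k g"
  using assms(1) by (rule vanish_bound[where C = 1]) (use assms(2) in \<open>auto elim: eventually_mono\<close>)

text \<open>A function \<open>h = c * e ^ j + O(e ^ (j + 1))\<close> with \<open>c \<noteq> 0\<close> is bounded below near \<open>r\<close>, because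
  the remainder eventually takes up at most half of the leading term. All denominators of the method
  are of this form, so this gives both their nonvanishing and the rule for dividing by them.\<close>

lemma leading_lower_bound:
  assumes "vanish r (Suc j) (\<lambda>x. h x - c * (x - r) ^ j)" "c \<noteq> 0"
  shows "\<forall>\<^sub>F x in at r. \<bar>c\<bar> / 2 * \<bar>x - r\<bar> ^ j \<le> \<bar>h x\<bar>"
proof -
  obtain C where C: "C > 0" "\<forall>\<^sub>F x in at r. norm (h x - c * (x - r) ^ j) \<le> C * norm ((x - r) ^ Suc j)"
    using assms(1) unfolding vanish_def by (auto elim: landau_o.bigE)
  have "\<forall>\<^sub>F x in at r. dist x r < \<bar>c\<bar> / (2 * C)"
    using C(1) assms(2) by (auto simp: eventually_at intro!: exI[of _ "\<bar>c\<bar> / (2 * C)"])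
  with C(2) show ?thesis
  proof eventually_elim
    case (elim x)
    have "C * \<bar>x - r\<bar> \<le> \<bar>c\<bar> / 2"
      using elim(2) C(1) by (simp add: dist_real_def field_simps)
    then have "C * \<bar>x - r\<bar> * \<bar>x - r\<bar> ^ j \<le> \<bar>c\<bar> / 2 * \<bar>x - r\<bar> ^ j"
      by (rule mult_right_mono) simp
    moreover have "\<bar>h x - c * (x - r) ^ j\<bar> \<le> C * \<bar>x - r\<bar> * \<bar>x - r\<bar> ^ j"
      using elim(1) by (simp add: abs_mult power_abs mult.assoc)
    moreover have "\<bar>c * (x - r) ^ j\<bar> \<le> \<bar>h x\<bar> + \<bar>h x - c * (x - r) ^ j\<bar>" by linarith
    moreover have "\<bar>c * (x - r) ^ j\<bar> = \<bar>c\<bar> * \<bar>x - r\<bar> ^ j" by (simp add: abs_mult power_abs)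
    ultimately show ?case by linarith
  qed
qed

lemma leading_nonzero:
  assumes "vanish r (Suc j) (\<lambda>x. h x - c * (x - r) ^ j)" "c \<noteq> 0"
  shows "\<forall>\<^sub>F x in at r. h x \<noteq> 0"
  using leading_lower_bound[OF assms] eventually_neq_at_within[of r r UNIV]
proof eventually_elim
  case (elim x)
  have "0 < \<bar>c\<bar> / 2 * \<bar>x - r\<bar> ^ j" using elim(2) assms(2) by simp
  then show ?case using elim(1) by auto
qed

lemma vanish_divide:
  assumes g: "vanish r (k + j) g"
    and h: "vanish r (Suc j) (\<lambda>x. h x - c * (x - r) ^ j)" "c \<noteq> 0"
  shows "vanish r k (\<lambda>x. g x / h x)"
proof -
  obtain C where C: "C > 0" "\<forall>\<^sub>F x in at r. norm (g x) \<le> C * norm ((x - r) ^ (k + j))"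
    using g unfolding vanish_def by (auto elim: landau_o.bigE)
  have "\<forall>\<^sub>F x in at r. \<bar>g x / h x\<bar> \<le> (2 * C / \<bar>c\<bar>) * \<bar>(x - r) ^ k\<bar>"
    using C(2) leading_lower_bound[OF h] leading_nonzero[OF h]
  proof eventually_elim
    case (elim x)
    have "\<bar>g x\<bar> \<le> C * \<bar>x - r\<bar> ^ k * \<bar>x - r\<bar> ^ j"
      using elim(1) by (simp add: abs_mult power_abs power_add mult.assoc)
    also have "\<dots> = (2 * C / \<bar>c\<bar>) * \<bar>x - r\<bar> ^ k * (\<bar>c\<bar> / 2 * \<bar>x - r\<bar> ^ j)"
      using h(2) by simp
    also have "\<dots> \<le> (2 * C / \<bar>c\<bar>) * \<bar>x - r\<bar> ^ k * \<bar>h x\<bar>"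
      using elim(2) C(1) by (intro mult_left_mono) auto
    finally show ?case using elim(3) by (simp add: field_simps power_abs)
  qed
  with vanish_power show ?thesis by (rule vanish_bound)
qed

lemma vanish_divide_unit:
  assumes "vanish r k g" "vanish r (Suc 0) (\<lambda>x. h x - c)" "c \<noteq> 0"
  shows "vanish r k (\<lambda>x. g x / h x)"
  using vanish_divide[of r k 0 g h c] assms by simp

section \<open>The cubic Taylor jet at a simple zero\<close>

text \<open>The third derivative, being continuous at \<open>r\<close>, is bounded nearby, so the Lagrange remainder of
  second order is cubic in \<open>t - r\<close>.\<close>

lemma quadratic_taylor_bound:
  fixes g :: "real \<Rightarrow> real"
  assumes "open D" "r \<in> D"
    and diff: "\<And>j t. j < 4 \<Longrightarrow> t \<in> D \<Longrightarrow> (deriv ^^ j) g field_differentiable at t"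
  shows "\<exists>c2 c3 K \<rho>. \<rho> > 0 \<and> (\<forall>t. \<bar>t - r\<bar> < \<rho> \<longrightarrow> 
     \<bar>g t - (g r + c2 * (t - r) + c3 * (t - r)\<^sup>2)\<bar> \<le> K * \<bar>t - r\<bar> ^ 3)"
proof -
  define d where "d = (\<lambda>j. (deriv ^^ j) g)"
  have D: "(d j has_real_derivative d (Suc j) t) (at t)" if "j < 4" "t \<in> D" for j t
    using diff[OF that] by (simp add: d_def field_differentiable_derivI)
  have "isCont (d 3) r" using D[of 3 r] assms(2) by (auto intro: DERIV_isCont)
  then have "(d 3 \<longlongrightarrow> d 3 r) (nhds r)" by (simp add: isCont_def tendsto_at_iff_tendsto_nhds)
  then have "\<forall>\<^sub>F t in nhds r. dist (d 3 t) (d 3 r) < 1" by (rule tendstoD) simp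
  moreover have "\<forall>\<^sub>F t in nhds r. t \<in> D" using assms(1,2) by (rule eventually_nhds_in_open)
  ultimately have "\<forall>\<^sub>F t in nhds r. dist (d 3 t) (d 3 r) < 1 \<and> t \<in> D" by (rule eventually_conj)
  then obtain \<rho> where \<rho>: "\<rho> > 0" "\<And>t. \<bar>t - r\<bar> < \<rho> \<Longrightarrow> dist (d 3 t) (d 3 r) < 1 \<and> t \<in> D"
    by (auto simp: eventually_nhds_metric dist_real_def)
  define M where "M = \<bar>d 3 r\<bar> + 1"
  have M: "\<bar>d 3 t\<bar> \<le> M" if "\<bar>t - r\<bar> < \<rho>" for t
    using \<rho>(2)[OF that] by (auto simp: M_def dist_real_def)
  have "\<bar>g t - (g r + d 1 r * (t - r) + d 2 r / 2 * (t - r)\<^sup>2)\<bar> \<le> M * \<bar>t - r\<bar> ^ 3"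
    if t: "\<bar>t - r\<bar> < \<rho>" for t
  proof (cases "t = r")
    case True
    then show ?thesis by simp
  next
    case False
    have "\<exists>s. (if t < r then t < s \<and> s < r else r < s \<and> s < t) \<and>
        g t = (\<Sum>m<3. d m r / fact m * (t - r) ^ m) + d 3 s / fact 3 * (t - r) ^ 3"
    proof (rule Taylor)
      show "\<forall>m s. m < 3 \<and> min r t \<le> s \<and> s \<le> max r t \<longrightarrow> (d m has_real_derivative d (Suc m) s) (at s)"
        using t by (auto intro!: D \<rho>(2)[THEN conjunct2])
    qed (use False in \<open>auto simp: d_def\<close>)
    then obtain s where s: "if t < r then t < s \<and> s < r else r < s \<and> s < t"
      and eq: "g t = (\<Sum>m<3. d m r / fact m * (t - r) ^ m) + d 3 s / fact 3 * (t - r) ^ 3" by blast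
    have "\<bar>s - r\<bar> < \<rho>" using s t by (auto split: if_splits)
    then have "\<bar>d 3 s\<bar> / 6 \<le> M" using M[of s] by simp
    then have "\<bar>d 3 s\<bar> / 6 * \<bar>t - r\<bar> ^ 3 \<le> M * \<bar>t - r\<bar> ^ 3" by (rule mult_right_mono) simp
    moreover have "g t - (g r + d 1 r * (t - r) + d 2 r / 2 * (t - r)\<^sup>2) = d 3 s / 6 * (t - r) ^ 3"
      unfolding eq by (simp add: eval_nat_numeral d_def)
    moreover have "\<bar>d 3 s / 6 * (t - r) ^ 3\<bar> = \<bar>d 3 s\<bar> / 6 * \<bar>t - r\<bar> ^ 3"
      by (simp add: abs_mult power_abs)
    ultimately show ?thesis by presburger
  qed
  then show ?thesis using \<rho>(1) by blast
qed

text \<open>The expansion is postulated for the derivative: a bound on the derivative of the Taylor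
  remainder controls its divided differences, also at confluent points, and together with \<open>f r = 0\<close>
  it yields the expansion of \<open>f\<close>.\<close>

locale simple_zero_jet =
  fixes f :: "real \<Rightarrow> real" and r c1 c2 c3 K \<rho> :: real
  assumes rho_pos: "\<rho> > 0" and zero: "f r = 0" and c1_nz: "c1 \<noteq> 0"
    and has_deriv: "\<bar>t - r\<bar> < \<rho> \<Longrightarrow> (f has_real_derivative deriv f t) (at t)"
    and jet: "\<bar>t - r\<bar> < \<rho> \<Longrightarrow>
      \<bar>deriv f t - (c1 + 2 * c2 * (t - r) + 3 * c3 * (t - r)\<^sup>2)\<bar> \<le> K * \<bar>t - r\<bar> ^ 3"
begin

text \<open>The divided difference of \<open>c1 * s + c2 * s ^ 2 + c3 * s ^ 3\<close> at \<open>a\<close> and \<open>b\<close>, in the polynomial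
  form that remains valid for \<open>a = b\<close>.\<close>

definition cubic_slope :: "real \<Rightarrow> real \<Rightarrow> real" where
  "cubic_slope a b = c1 + c2 * (a + b) + c3 * (a\<^sup>2 + a * b + b\<^sup>2)"

lemma K_nonneg: "K \<ge> 0"
proof -
  have "0 \<le> K * \<bar>(r + \<rho> / 2) - r\<bar> ^ 3" using jet[of "r + \<rho> / 2"] rho_pos by linarith
  then show ?thesis using rho_pos by (simp add: zero_le_mult_iff)
qed

text \<open>The error is the first divided difference of the Taylor remainder \<open>G\<close>. By the mean value
  theorem it is a value of \<open>G'\<close> between \<open>a\<close> and \<open>b\<close>. The case \<open>a = b\<close> is included because \<open>y\<close>
  and \<open>z\<close> coincide when \<open>f y = 0\<close>.\<close>

lemma slope_near_cubic:
  assumes a: "\<bar>a - r\<bar> < \<rho>" and b: "\<bar>b - r\<bar> < \<rho>"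
  shows "\<bar>div_diff f [a, b] - cubic_slope (a - r) (b - r)\<bar> \<le> K * (\<bar>a - r\<bar> + \<bar>b - r\<bar>) ^ 3"
proof -
  have mono: "K * \<bar>s - r\<bar> ^ 3 \<le> K * (\<bar>a - r\<bar> + \<bar>b - r\<bar>) ^ 3"
    if "min a b \<le> s" "s \<le> max a b" for s
    using that by (intro mult_left_mono power_mono K_nonneg) auto
  define G where "G = (\<lambda>t. f t - (c1 * (t - r) + c2 * (t - r)\<^sup>2 + c3 * (t - r) ^ 3))"
  define G' where "G' = (\<lambda>t. deriv f t - (c1 + 2 * c2 * (t - r) + 3 * c3 * (t - r)\<^sup>2))"
  have G: "(G has_real_derivative G' t) (at t)" if "\<bar>t - r\<bar> < \<rho>" for t
    unfolding G_def G'_def by (rule has_deriv[OF that] derivative_eq_intros refl)+ simp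
  have main: "\<bar>div_diff f [p, q] - cubic_slope (p - r) (q - r)\<bar> \<le> K * (\<bar>a - r\<bar> + \<bar>b - r\<bar>) ^ 3"
    if pq: "p < q" "{p, q} = {a, b}" for p q
  proof -
    have "\<exists>s. p < s \<and> s < q \<and> G q - G p = (q - p) * G' s"
      using pq a b by (intro MVT2 G) (auto simp: doubleton_eq_iff)
    then obtain s where s: "p < s" "s < q" "G q - G p = (q - p) * G' s" by blast
    have "div_diff f [p, q] - cubic_slope (p - r) (q - r) = (G q - G p) / (q - p)"
      using pq(1) unfolding G_def cubic_slope_def
      by (simp add: field_simps) algebra
    also have "\<dots> = G' s" using s by simp
    finally have eq: "div_diff f [p, q] - cubic_slope (p - r) (q - r) = G' s" .
    have "\<bar>s - r\<bar> < \<rho>" "min a b \<le> s" "s \<le> max a b"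
      using s(1,2) pq a b by (auto simp: doubleton_eq_iff)
    then have "\<bar>G' s\<bar> \<le> K * (\<bar>a - r\<bar> + \<bar>b - r\<bar>) ^ 3"
      unfolding G'_def using jet[of s] mono[of s] by linarith
    then show ?thesis unfolding eq .
  qed
  consider "a = b" | "a < b" | "b < a" by linarith
  then show ?thesis
  proof cases
    case 1
    have "cubic_slope (a - r) (a - r) = c1 + 2 * c2 * (a - r) + 3 * c3 * (a - r)\<^sup>2"
      by (simp add: cubic_slope_def power2_eq_square)
    then have "\<bar>div_diff f [a, b] - cubic_slope (a - r) (b - r)\<bar> \<le> K * \<bar>a - r\<bar> ^ 3"
      using 1 jet[OF a] by simp
    also have "\<dots> \<le> K * (\<bar>a - r\<bar> + \<bar>b - r\<bar>) ^ 3" using 1 by (intro mono) auto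
    finally show ?thesis .
  next
    case 2
    then show ?thesis using main by blast
  next
    case 3
    have "div_diff f [b, a] = div_diff f [a, b]" using 3 by (simp add: field_simps)
    moreover have "cubic_slope (b - r) (a - r) = cubic_slope (a - r) (b - r)"
      by (simp add: cubic_slope_def algebra_simps)
    ultimately show ?thesis using main[of b a] 3 by auto
  qed
qed

lemma eventually_near:
  assumes "(g \<longlongrightarrow> r) (at r)"
  shows "\<forall>\<^sub>F x in at r. \<bar>g x - r\<bar> < \<rho>"
  using tendstoD[OF assms rho_pos] by (simp add: dist_real_def)

lemma vanish_imp_tendsto:
  assumes "vanish r k (\<lambda>x. g x - r)" "0 < k"
  shows "(g \<longlongrightarrow> r) (at r)"
  using vanish_tendsto[OF assms] by (simp add: LIM_zero_iff)

lemma vanish_slope_error: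
  assumes "vanish r k (\<lambda>x. a x - r)" "vanish r k (\<lambda>x. b x - r)" "0 < k"
  shows "vanish r (3 * k) (\<lambda>x. div_diff f [a x, b x] - cubic_slope (a x - r) (b x - r))"
proof -
  have "vanish r (3 * k) (\<lambda>x. (\<bar>a x - r\<bar> + \<bar>b x - r\<bar>) ^ 3)"
    by (intro vanish_pow vanish_add vanish_abs assms)
  moreover have "\<forall>\<^sub>F x in at r. \<bar>div_diff f [a x, b x] - cubic_slope (a x - r) (b x - r)\<bar>
      \<le> K * \<bar>(\<bar>a x - r\<bar> + \<bar>b x - r\<bar>) ^ 3\<bar>"
    using eventually_near[OF vanish_imp_tendsto[OF assms(1,3)]]
      eventually_near[OF vanish_imp_tendsto[OF assms(2,3)]]
    by eventually_elim (use slope_near_cubic in simp)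
  ultimately show ?thesis by (rule vanish_bound)
qed

text \<open>As \<open>f r = 0\<close>, the value \<open>f t\<close> is \<open>t - r\<close> times the divided difference at \<open>r\<close> and \<open>t\<close>, so the
  slope estimate gains one order.\<close>

lemma vanish_value_error:
  assumes "vanish r k (\<lambda>x. g x - r)" "0 < k"
  shows "vanish r (4 * k) (\<lambda>x. f (g x) - (c1 * (g x - r) + c2 * (g x - r)\<^sup>2 + c3 * (g x - r) ^ 3))"
proof -
  have "vanish r (k + 3 * k) (\<lambda>x. (g x - r) * (div_diff f [r, g x] - cubic_slope (r - r) (g x - r)))"
    using vanish_mult[OF assms(1) vanish_slope_error[of k "\<lambda>_. r" g]] assms
      vanish_const[of r 0] by (simp add: vanish_def)
  moreover have "(g x - r) * (div_diff f [r, g x] - cubic_slope (r - r) (g x - r))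
     = f (g x) - (c1 * (g x - r) + c2 * (g x - r)\<^sup>2 + c3 * (g x - r) ^ 3)" for x
  proof (cases "g x = r")
    case False
    then have "(g x - r) * div_diff f [r, g x] = f (g x)" by (simp add: zero)
    moreover have "(g x - r) * cubic_slope (r - r) (g x - r)
        = c1 * (g x - r) + c2 * (g x - r)\<^sup>2 + c3 * (g x - r) ^ 3"
      by (simp add: cubic_slope_def algebra_simps power2_eq_square power3_eq_cube)
    ultimately show ?thesis by (simp only: right_diff_distrib)
  qed (simp add: zero)
  ultimately show ?thesis by simp
qed

lemma value_linear:
  assumes g: "vanish r k (\<lambda>x. g x - r)" and "0 < k"
  shows "vanish r (2 * k) (\<lambda>x. f (g x) - c1 * (g x - r))"
proof -
  have "vanish r (2 * k) (\<lambda>x. (f (g x) - (c1 * (g x - r) + c2 * (g x - r)\<^sup>2 + c3 * (g x - r) ^ 3))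
      + (c2 * (g x - r)\<^sup>2 + c3 * (g x - r) ^ 3))"
    by (intro vanish_add vanish_cmult vanish_pow g
        vanish_mono[OF vanish_pow[OF g, of 3]] vanish_mono[OF vanish_value_error[OF assms]]) auto
  then show ?thesis by (simp add: algebra_simps)
qed

section \<open>The Newton point\<close>

lemma deriv_expansion: "vanish r 2 (\<lambda>x. deriv f x - c1 - 2 * c2 * (x - r))"
proof -
  have "vanish r 3 (\<lambda>x. deriv f x - cubic_slope (x - r) (x - r))"
    using vanish_slope_error[OF vanish_dist vanish_dist] by simp
  then have "vanish r 2 (\<lambda>x. (deriv f x - cubic_slope (x - r) (x - r)) + 3 * c3 * (x - r) ^ 2)"
    by (intro vanish_add vanish_cmult vanish_power) (auto intro: vanish_mono)
  moreover have "deriv f x - c1 - 2 * c2 * (x - r) =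
      (deriv f x - cubic_slope (x - r) (x - r)) + 3 * c3 * (x - r) ^ 2" for x
    by (simp add: cubic_slope_def power2_eq_square algebra_simps)
  ultimately show ?thesis by presburger
qed

lemma deriv_leading: "vanish r (Suc 0) (\<lambda>x. deriv f x - c1)"
proof -
  have "vanish r (Suc 0) (\<lambda>x. (deriv f x - c1 - 2 * c2 * (x - r)) + 2 * c2 * (x - r))"
    by (intro vanish_add vanish_cmult vanish_dist vanish_mono[OF deriv_expansion]) simp
  then show ?thesis by simp
qed

lemma value_expansion: "vanish r 3 (\<lambda>x. f x - c1 * (x - r) - c2 * (x - r)\<^sup>2)"
proof -
  have "vanish r 3 (\<lambda>x. (f x - (c1 * (x - r) + c2 * (x - r)\<^sup>2 + c3 * (x - r) ^ 3)) + c3 * (x - r) ^ 3)"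
    by (intro vanish_add vanish_cmult vanish_power vanish_mono[OF vanish_value_error[OF vanish_dist]]) auto
  then show ?thesis by (simp add: algebra_simps)
qed

lemma value_leading: "vanish r (Suc (Suc 0)) (\<lambda>x. f x - c1 * (x - r) ^ Suc 0)"
  using value_linear[OF vanish_dist] by (simp add: numeral_2_eq_2)

lemma value_nonzero: "\<forall>\<^sub>F x in at r. f x \<noteq> 0"
  using leading_nonzero[OF value_leading c1_nz] .

lemma deriv_nonzero: "\<forall>\<^sub>F x in at r. deriv f x \<noteq> 0"
  using leading_nonzero[of r 0 "deriv f" c1] deriv_leading c1_nz by simp

lemma value_order: "vanish r (Suc 0) f"
proof -
  have "vanish r (Suc 0) (\<lambda>x. (f x - c1 * (x - r) ^ Suc 0) + c1 * (x - r))"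
    by (intro vanish_add vanish_cmult vanish_dist vanish_mono[OF value_leading]) simp
  then show ?thesis by simp
qed

lemma newton_u_order: "vanish r (Suc 0) (newton_u f)"
  using vanish_divide_unit[OF value_order deriv_leading c1_nz]
  by (simp add: newton_u_def[abs_def])

text \<open>Here \<open>y - r = (e * f' x - f x) / f' x\<close>. The linear terms of the numerator cancel and leave
  \<open>c2 * e ^ 2\<close>; the combination bounded first is this numerator minus \<open>(c2 / c1) * e ^ 2 * f' x\<close>.\<close>

lemma newton_y_expansion: "vanish r 3 (\<lambda>x. newton_y f x - r - c2 / c1 * (x - r)\<^sup>2)"
proof -
  have "vanish r 3 (\<lambda>x. (x - r) * (deriv f x - c1 - 2 * c2 * (x - r))
      - (f x - c1 * (x - r) - c2 * (x - r)\<^sup>2)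
      - c2 / c1 * ((x - r)\<^sup>2 * (deriv f x - c1)))" (is "vanish r 3 ?N")
    using vanish_mult[OF vanish_dist deriv_expansion]
      vanish_mult[OF vanish_power[of r 2] deriv_leading]
    by (intro vanish_diff vanish_cmult value_expansion) (simp_all add: eval_nat_numeral)
  from vanish_divide_unit[OF this deriv_leading c1_nz] show ?thesis
  proof (rule vanish_cong)
    show "\<forall>\<^sub>F x in at r. newton_y f x - r - c2 / c1 * (x - r)\<^sup>2 = ?N x / deriv f x"
      using deriv_nonzero
    proof eventually_elim
      case (elim x)
      then show ?case using c1_nz
        by (simp add: newton_y_def newton_u_def divide_simps) algebra
    qed
  qed
qed

lemma newton_y_order: "vanish r 2 (\<lambda>x. newton_y f x - r)"
proof -
  have "vanish r 2 (\<lambda>x. (newton_y f x - r - c2 / c1 * (x - r)\<^sup>2) + c2 / c1 * (x - r)\<^sup>2)"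
    by (intro vanish_add vanish_cmult vanish_power vanish_mono[OF newton_y_expansion]) simp
  then show ?thesis by simp
qed

lemma value_newton_y: "vanish r 4 (\<lambda>x. f (newton_y f x) - c1 * (newton_y f x - r))"
  using value_linear[OF newton_y_order] by simp

text \<open>To first order \<open>f y / f x\<close> equals \<open>(c2 / c1) * e\<close>, which is half the relative change of \<open>f'\<close>
  between \<open>r\<close> and \<open>x\<close>. It thus measures that change without another evaluation of \<open>f'\<close>.\<close>

lemma ratio_expansion: "vanish r 2 (\<lambda>x. f (newton_y f x) / f x - c2 / c1 * (x - r))"
proof -
  have "vanish r 3 (\<lambda>x. (f (newton_y f x) - c1 * (newton_y f x - r))
      + c1 * (newton_y f x - r - c2 / c1 * (x - r)\<^sup>2)
      - c2 / c1 * ((x - r) * (f x - c1 * (x - r) ^ Suc 0)))" (is "vanish r 3 ?N")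
    using vanish_mult[OF vanish_dist value_leading]
    by (intro vanish_diff vanish_add vanish_cmult newton_y_expansion vanish_mono[OF value_newton_y])
      (simp_all add: eval_nat_numeral)
  then have "vanish r (2 + Suc 0) ?N" by (simp add: eval_nat_numeral)
  from vanish_divide[OF this value_leading c1_nz] show ?thesis
  proof (rule vanish_cong)
    show "\<forall>\<^sub>F x in at r. f (newton_y f x) / f x - c2 / c1 * (x - r) = ?N x / f x"
      using value_nonzero
    proof eventually_elim
      case (elim x)
      then show ?case using c1_nz by (simp add: divide_simps) algebra
    qed
  qed
qed

lemma ratio_order: "vanish r (Suc 0) (\<lambda>x. f (newton_y f x) / f x)"
proof -
  have "vanish r (Suc 0) (\<lambda>x. (f (newton_y f x) / f x - c2 / c1 * (x - r)) + c2 / c1 * (x - r))"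
    by (intro vanish_add vanish_cmult vanish_dist vanish_mono[OF ratio_expansion]) simp
  then show ?thesis by simp
qed

section \<open>The fourth-order point\<close>

lemma one_plus_u_leading: "vanish r (Suc 0) (\<lambda>x. (1 + newton_u f x) - 1)"
  using newton_u_order by simp

lemma one_plus_u_nonzero: "\<forall>\<^sub>F x in at r. 1 + newton_u f x \<noteq> 0"
  using leading_nonzero[of r 0 "\<lambda>x. 1 + newton_u f x" 1] newton_u_order by simp

text \<open>With \<open>t = f y / f x\<close>, \<open>d = y - r\<close> and \<open>q = u / (1 + u)\<close>, the weight is
  \<open>1 + t + (2 - q) * t ^ 2\<close>. Multiplying \<open>z - r\<close> by \<open>f' x\<close> splits it into three terms of order 4:
  \<open>d\<close> times the error of \<open>c1 * (1 + 2 * t)\<close> as an approximation of \<open>f' x\<close>, the nonlinear part of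
  \<open>f y\<close>, and \<open>f y * t * q\<close>. The value \<open>2\<close> of \<open>2 - q\<close> at \<open>x = r\<close> is what makes the second
  factor of the first term \<open>O(e ^ 2)\<close> instead of \<open>O(e)\<close>.\<close>

lemma step_z_order: "vanish r 4 (\<lambda>x. step_z f x - r)"
proof -
  let ?d = "\<lambda>x. newton_y f x - r" and ?t = "\<lambda>x. f (newton_y f x) / f x"
  have weight: "vanish r 2 (\<lambda>x. deriv f x - c1 - 2 * c1 * ?t x)"
  proof -
    have "vanish r 2 (\<lambda>x. (deriv f x - c1 - 2 * c2 * (x - r)) - 2 * c1 * (?t x - c2 / c1 * (x - r)))"
      by (intro vanish_diff vanish_cmult deriv_expansion ratio_expansion)
    moreover have "deriv f x - c1 - 2 * c1 * ?t x =
        (deriv f x - c1 - 2 * c2 * (x - r)) - 2 * c1 * (?t x - c2 / c1 * (x - r))" for x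
      using c1_nz by (simp add: right_diff_distrib)
    ultimately show ?thesis by presburger
  qed
  have fy: "vanish r 2 (\<lambda>x. f (newton_y f x))"
  proof -
    have "vanish r 2 (\<lambda>x. (f (newton_y f x) - c1 * ?d x) + c1 * ?d x)"
      by (intro vanish_add vanish_cmult newton_y_order vanish_mono[OF value_newton_y]) simp
    then show ?thesis by simp
  qed
  have bounded: "vanish r 0 (\<lambda>x. 1 + 2 * ?t x)"
    by (intro vanish_add vanish_const vanish_cmult vanish_mono[OF ratio_order]) simp
  have w: "vanish r (Suc 0) (\<lambda>x. newton_u f x / (1 + newton_u f x))"
    by (rule vanish_divide_unit[OF newton_u_order one_plus_u_leading]) simp
  have "vanish r 4 (\<lambda>x. ?d x * (deriv f x - c1 - 2 * c1 * ?t x)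
      - (f (newton_y f x) - c1 * ?d x) * (1 + 2 * ?t x)
      + f (newton_y f x) * ?t x * (newton_u f x / (1 + newton_u f x)))" (is "vanish r 4 ?N")
    using vanish_mult[OF newton_y_order weight] vanish_mult[OF value_newton_y bounded]
      vanish_mult[OF vanish_mult[OF fy ratio_order] w]
    by (intro vanish_diff vanish_add) (simp_all add: eval_nat_numeral)
  from vanish_divide_unit[OF this deriv_leading c1_nz] show ?thesis
  proof (rule vanish_cong)
    show "\<forall>\<^sub>F x in at r. step_z f x - r = ?N x / deriv f x"
      using deriv_nonzero value_nonzero one_plus_u_nonzero
    proof eventually_elim
      case (elim x)
      have identity: "(x - u * (1 + t + (2 - q) * t\<^sup>2) - r) * m
          = (x - u - r) * (m - c1 - 2 * c1 * t) - (t * u * m - c1 * (x - u - r)) * (1 + 2 * t)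
            + t * u * m * t * q" for u t q m :: real
        by algebra
      have y: "newton_y f x = x - newton_u f x" by (simp add: newton_y_def)
      have fy: "f (newton_y f x) = ?t x * newton_u f x * deriv f x"
        using elim by (simp add: newton_u_def)
      have q: "1 + 1 / (1 + newton_u f x) = 2 - newton_u f x / (1 + newton_u f x)"
        using elim(3) by (simp add: field_simps)
      have "(step_z f x - r) * deriv f x = ?N x"
        using identity[of "newton_u f x" "?t x" "newton_u f x / (1 + newton_u f x)" "deriv f x"]
        unfolding step_z_def q fy[symmetric] y[symmetric] .
      with elim(1) show ?case by (rule eq_divide_imp)
    qed
  qed
qed

section \<open>The slope of the last correction\<close>

lemma x_minus_y_leading: "vanish r (Suc (Suc 0)) (\<lambda>x. (x - newton_y f x) - 1 * (x - r) ^ Suc 0)"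
proof -
  have "vanish r (Suc (Suc 0)) (\<lambda>x. (-1) * (newton_y f x - r))"
    using newton_y_order by (intro vanish_cmult) (simp add: numeral_2_eq_2)
  then show ?thesis by (simp add: algebra_simps)
qed

lemma x_minus_z_leading: "vanish r (Suc (Suc 0)) (\<lambda>x. (x - step_z f x) - 1 * (x - r) ^ Suc 0)"
proof -
  have "vanish r (Suc (Suc 0)) (\<lambda>x. (-1) * (step_z f x - r))"
    by (intro vanish_cmult vanish_mono[OF step_z_order]) simp
  then show ?thesis by (simp add: algebra_simps)
qed

lemma y_neq_x: "\<forall>\<^sub>F x in at r. newton_y f x \<noteq> x"
  using leading_nonzero[OF x_minus_y_leading] by (auto elim: eventually_mono)

lemma z_neq_x: "\<forall>\<^sub>F x in at r. step_z f x \<noteq> x"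
  using leading_nonzero[OF x_minus_z_leading] by (auto elim: eventually_mono)

text \<open>The slope is a linear combination of \<open>f[z,y]\<close>, \<open>f[y,x]\<close> and \<open>f[x,x]\<close>. Replacing these by the
  slopes of the cubic jet gives exactly the derivative \<open>c1 + 2 * c2 * w + 3 * c3 * w ^ 2\<close> of the jet
  at \<open>w = z - r = O(e ^ 4)\<close>. The replacement errors \<open>\<alpha>\<close>, \<open>\<beta>\<close>, \<open>\<gamma>\<close> have orders 6, 3, 3; they
  propagate to \<open>\<sigma>\<close>, \<open>\<tau>\<close> and \<open>\<upsilon>\<close>, of orders 2, 2 and 1, which are the errors of \<open>f[z,y,x]\<close>,
  \<open>f[y,x,x]\<close> and \<open>f[z,y,x,x]\<close>. In the slope \<open>\<sigma>\<close> is multiplied by \<open>z - y\<close> of order 2, and \<open>\<upsilon>\<close> by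
  \<open>(z - y) * (z - x)\<close> of order 3, so every error has order at least 4.\<close>

lemma slope_z_order: "vanish r 4 (\<lambda>x. slope_z f x - c1)"
proof -
  let ?e = "\<lambda>x. x - r" and ?d = "\<lambda>x. newton_y f x - r" and ?w = "\<lambda>x. step_z f x - r"
  let ?z = "step_z f" and ?y = "newton_y f"
  define \<alpha> where "\<alpha> = (\<lambda>x. div_diff f [?z x, ?y x] - cubic_slope (?w x) (?d x))"
  define \<beta> where "\<beta> = (\<lambda>x. div_diff f [?y x, x] - cubic_slope (?d x) (?e x))"
  define \<gamma> where "\<gamma> = (\<lambda>x. div_diff f [x, x] - cubic_slope (?e x) (?e x))"
  define \<sigma> where "\<sigma> = (\<lambda>x. (\<beta> x - \<alpha> x) / (x - ?z x))"
  define \<tau> where "\<tau> = (\<lambda>x. (\<gamma> x - \<beta> x) / (x - ?y x))"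
  define \<upsilon> where "\<upsilon> = (\<lambda>x. (\<tau> x - \<sigma> x) / (x - ?z x))"
  have a: "vanish r 6 \<alpha>"
    using vanish_slope_error[of 2 ?z ?y] vanish_mono[OF step_z_order] newton_y_order
    by (simp add: \<alpha>_def)
  have b: "vanish r 3 \<beta>"
    using vanish_slope_error[of "Suc 0" ?y "\<lambda>x. x"] vanish_mono[OF newton_y_order] vanish_dist
    by (simp add: \<beta>_def)
  have c: "vanish r 3 \<gamma>"
    using vanish_slope_error[OF vanish_dist vanish_dist] by (simp add: \<gamma>_def)
  have s: "vanish r 2 \<sigma>" unfolding \<sigma>_def
  proof (rule vanish_divide[OF _ x_minus_z_leading])
    show "vanish r (2 + Suc 0) (\<lambda>x. \<beta> x - \<alpha> x)"
      using b a by (intro vanish_diff) (auto intro: vanish_mono)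
  qed simp
  have t: "vanish r 2 \<tau>" unfolding \<tau>_def
  proof (rule vanish_divide[OF _ x_minus_y_leading])
    show "vanish r (2 + Suc 0) (\<lambda>x. \<gamma> x - \<beta> x)"
      using b c by (intro vanish_diff) (auto intro: vanish_mono)
  qed simp
  have u: "vanish r 1 \<upsilon>" unfolding \<upsilon>_def
  proof (rule vanish_divide[OF _ x_minus_z_leading])
    show "vanish r (1 + Suc 0) (\<lambda>x. \<tau> x - \<sigma> x)"
      using s t by (intro vanish_diff) (auto intro: vanish_mono)
  qed simp
  have w2: "vanish r 2 ?w" by (rule vanish_mono[OF step_z_order]) simp
  have wd: "vanish r 2 (\<lambda>x. ?w x - ?d x)"
    by (intro vanish_diff w2 newton_y_order)
  have "vanish r 1 ?w" by (rule vanish_mono[OF step_z_order]) simp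
  moreover have "vanish r 1 ?e" using vanish_dist by simp
  ultimately have we: "vanish r 1 (\<lambda>x. ?w x - ?e x)" by (rule vanish_diff)

  have "vanish r 4 (\<lambda>x. 2 * c2 * ?w x + 3 * c3 * ?w x ^ 2 + \<alpha> x + (?w x - ?d x) * \<sigma> x
      + (?w x - ?d x) * (?w x - ?e x) * \<upsilon> x)" (is "vanish r 4 ?N")
    using vanish_mult[OF wd s] vanish_mult[OF vanish_mult[OF wd we] u] vanish_pow[OF w2, of 2]
    by (intro vanish_add vanish_cmult step_z_order vanish_mono[OF a]) simp_all
  then show ?thesis
  proof (rule vanish_cong)
    show "\<forall>\<^sub>F x in at r. slope_z f x - c1 = ?N x"
      using y_neq_x z_neq_x
    proof eventually_elim
      case (elim x)
      define e d w where "e = ?e x" and "d = ?d x" and "w = ?w x"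
      have ew: "x - ?z x = e - w" "e - w \<noteq> 0" and ed: "x - ?y x = e - d" "e - d \<noteq> 0"
        and wd: "?z x - ?y x = w - d" and we: "?z x - x = w - e"
        using elim by (auto simp: e_def d_def w_def)
      have A: "div_diff f [?z x, ?y x] = cubic_slope w d + \<alpha> x"
        and B: "div_diff f [?y x, x] = cubic_slope d e + \<beta> x"
        and C: "div_diff f [x, x] = cubic_slope e e + \<gamma> x"
        by (simp_all add: \<alpha>_def \<beta>_def \<gamma>_def e_def d_def w_def)
      have "div_diff f [?z x, ?y x, x] = (div_diff f [?y x, x] - div_diff f [?z x, ?y x]) / (e - w)"
        using ew(1) by simp
      also have "\<dots> = c2 + c3 * (d + e + w) + \<sigma> x"
      proof -
        have "cubic_slope d e - cubic_slope w d = (c2 + c3 * (d + e + w)) * (e - w)"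
          unfolding cubic_slope_def by algebra
        moreover have "\<beta> x - \<alpha> x = \<sigma> x * (e - w)" using ew by (simp add: \<sigma>_def)
        ultimately have "div_diff f [?y x, x] - div_diff f [?z x, ?y x]
            = (c2 + c3 * (d + e + w) + \<sigma> x) * (e - w)" unfolding A B by algebra
        then show ?thesis using ew(2) by simp
      qed
      finally have zyx: "div_diff f [?z x, ?y x, x] = c2 + c3 * (d + e + w) + \<sigma> x" .
      have "div_diff f [?y x, x, x] = (div_diff f [x, x] - div_diff f [?y x, x]) / (e - d)"
        using ed(1) by simp
      also have "\<dots> = c2 + c3 * (d + 2 * e) + \<tau> x"
      proof -
        have "cubic_slope e e - cubic_slope d e = (c2 + c3 * (d + 2 * e)) * (e - d)"
          unfolding cubic_slope_def by algebra
        moreover have "\<gamma> x - \<beta> x = \<tau> x * (e - d)" using ed by (simp add: \<tau>_def)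
        ultimately have "div_diff f [x, x] - div_diff f [?y x, x]
            = (c2 + c3 * (d + 2 * e) + \<tau> x) * (e - d)" unfolding B C by algebra
        then show ?thesis using ed(2) by simp
      qed
      finally have yxx: "div_diff f [?y x, x, x] = c2 + c3 * (d + 2 * e) + \<tau> x" .
      have "div_diff f [?z x, ?y x, x, x]
          = (div_diff f [?y x, x, x] - div_diff f [?z x, ?y x, x]) / (e - w)"
        using ew(1) by simp
      also have "\<dots> = c3 + \<upsilon> x"
      proof -
        have "\<tau> x - \<sigma> x = \<upsilon> x * (e - w)" using ew by (simp add: \<upsilon>_def)
        then have "div_diff f [?y x, x, x] - div_diff f [?z x, ?y x, x] = (c3 + \<upsilon> x) * (e - w)"
          unfolding zyx yxx by algebra
        then show ?thesis using ew(2) by simp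
      qed
      finally have zyxx: "div_diff f [?z x, ?y x, x, x] = c3 + \<upsilon> x" .
      show ?case
        unfolding slope_z_def Let_def zyx zyxx A wd we cubic_slope_def
        unfolding e_def[symmetric] d_def[symmetric] w_def[symmetric] by algebra
    qed
  qed
qed

lemma slope_z_leading: "vanish r (Suc 0) (\<lambda>x. slope_z f x - c1)"
  by (rule vanish_mono[OF slope_z_order]) simp

lemma slope_z_nonzero: "\<forall>\<^sub>F x in at r. slope_z f x \<noteq> 0"
  using leading_nonzero[of r 0 "slope_z f" c1] slope_z_leading c1_nz by simp

section \<open>One complete step\<close>

text \<open>The numerator of \<open>x' - r\<close> over the slope is \<open>(z - r) * slope - f z\<close>. Comparing both terms with
  \<open>c1 * (z - r)\<close> leaves \<open>O(e ^ 4) * O(e ^ 4)\<close> from the slope and \<open>O((z - r) ^ 2)\<close> from \<open>f z\<close>.\<close>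

lemma step_next_order: "vanish r 8 (\<lambda>x. step_next f x - r)"
proof -
  have "vanish r 8 (\<lambda>x. (step_z f x - r) * (slope_z f x - c1))"
    using vanish_mult[OF step_z_order slope_z_order] by simp
  moreover have "vanish r 8 (\<lambda>x. f (step_z f x) - c1 * (step_z f x - r))"
    using value_linear[OF step_z_order] by simp
  ultimately have "vanish r 8 (\<lambda>x. (step_z f x - r) * (slope_z f x - c1)
      - (f (step_z f x) - c1 * (step_z f x - r)))" (is "vanish r 8 ?N")
    by (rule vanish_diff)
  from vanish_divide_unit[OF this slope_z_leading c1_nz] show ?thesis
  proof (rule vanish_cong)
    show "\<forall>\<^sub>F x in at r. step_next f x - r = ?N x / slope_z f x"
      using slope_z_nonzero
      by eventually_elim (simp add: step_next_def divide_simps, algebra)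
  qed
qed

lemma step_defined_near:
  assumes "open D" "r \<in> D"
  shows "\<forall>\<^sub>F x in at r. step_defined f D x"
proof -
  have inD: "\<forall>\<^sub>F x in at r. g x \<in> D" if "vanish r k (\<lambda>x. g x - r)" "0 < k" for g k
    using vanish_imp_tendsto[OF that] assms by (rule topological_tendstoD)
  show ?thesis
    using inD[OF vanish_dist zero_less_Suc] inD[OF newton_y_order zero_less_numeral]
      inD[OF step_z_order zero_less_numeral]
      deriv_nonzero value_nonzero one_plus_u_nonzero y_neq_x z_neq_x slope_z_nonzero
  proof eventually_elim
    case (elim x)
    \<comment> \<open>\<open>z = y\<close> may occur; then the pair is the confluent base case\<close>
    have "div_diff_defined [step_z f x, newton_y f x]" by simp
    moreover have "div_diff_defined [newton_y f x, x, x]" using elim(7) by simp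
    ultimately show ?case using elim unfolding step_defined_def Let_def by simp
  qed
qed

end

section \<open>Iterating a map that contracts to high order\<close>

text \<open>Since \<open>p \<ge> 2\<close>, one factor of \<open>\<bar>x - r\<bar> ^ p\<close> can be kept while the rest, times \<open>C\<close>, is at most
  \<open>1 / 2\<close> close to \<open>r\<close>. So each step halves the distance, which keeps the iterates in the region where
  the bound applies.\<close>

lemma iter_seq_converges_with_order:
  assumes p: "p \<ge> 2" and C: "C \<ge> 0" and \<eta>: "\<eta> > 0"
    and step: "\<And>x. x \<noteq> r \<Longrightarrow> \<bar>x - r\<bar> < \<eta> \<Longrightarrow> \<bar>step_next f x - r\<bar> \<le> C * \<bar>x - r\<bar> ^ p"
  shows "\<exists>\<delta>>0. \<delta> \<le> \<eta> \<and> (\<forall>x0. \<bar>x0 - r\<bar> < \<delta> \<longrightarrow>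
    (\<forall>n. \<bar>iter_seq f r x0 n - r\<bar> < \<delta>) \<and> converges_with_order p (iter_seq f r x0) r)"
proof -
  \<comment> \<open>\<open>\<delta> \<le> 1\<close> reduces the exponent \<open>p\<close> to \<open>2\<close>; \<open>C + 1\<close> avoids dividing by zero\<close>
  define \<delta> where "\<delta> = min \<eta> (min 1 (1 / (2 * (C + 1))))"
  have \<delta>: "0 < \<delta>" "\<delta> \<le> \<eta>" "\<delta> \<le> 1" "C * \<delta> \<le> 1 / 2"
  proof -
    have "C * \<delta> \<le> C * (1 / (2 * (C + 1)))" using C by (intro mult_left_mono) (auto simp: \<delta>_def)
    also have "\<dots> \<le> 1 / 2" using C by (simp add: field_simps)
    finally show "C * \<delta> \<le> 1 / 2" .
    show "\<delta> \<le> 1" unfolding \<delta>_def by (rule min.coboundedI2, rule min.cobounded1)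
  qed (use C \<eta> in \<open>auto simp: \<delta>_def\<close>)
  have "(\<forall>n. \<bar>iter_seq f r x0 n - r\<bar> < \<delta>) \<and> converges_with_order p (iter_seq f r x0) r"
    if x0: "\<bar>x0 - r\<bar> < \<delta>" for x0
  proof -
    define E where "E = (\<lambda>n. \<bar>iter_seq f r x0 n - r\<bar>)"
    have ord: "E (Suc n) \<le> C * E n ^ p" if "E n < \<delta>" for n
      using step[of "iter_seq f r x0 n"] that \<delta>(2) C by (auto simp: E_def)
    have half: "E (Suc n) \<le> E n / 2" if En: "E n < \<delta>" for n
    proof -
      have E: "0 \<le> E n" "E n \<le> 1" using En \<delta>(3) by (auto simp: E_def)
      have "E n ^ p \<le> E n ^ 2" using E p by (intro power_decreasing) auto
      then have "C * E n ^ p \<le> C * E n * E n"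
        using C by (simp add: power2_eq_square mult.assoc mult_left_mono)
      also have "\<dots> \<le> (C * \<delta>) * E n" using En C E by (intro mult_right_mono mult_left_mono) auto
      also have "\<dots> \<le> 1 / 2 * E n" using \<delta>(4) E by (intro mult_right_mono) auto
      finally show ?thesis using ord[OF En] by simp
    qed
    have geo: "E n < \<delta> \<and> E n \<le> \<delta> * (1 / 2) ^ n" for n
    proof (induction n)
      case 0
      show ?case using x0 by (simp add: E_def)
    next
      case (Suc n)
      moreover have "0 \<le> E n" by (simp add: E_def)
      ultimately show ?case using half[of n] by auto
    qed
    have "\<forall>n. norm (iter_seq f r x0 n - r) \<le> \<delta> * (1 / 2) ^ n"
      using geo unfolding E_def real_norm_def by (intro allI) (rule conjunct2)
    then have "\<forall>\<^sub>F n in sequentially. norm (iter_seq f r x0 n - r) \<le> \<delta> * (1 / 2) ^ n"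
      by (rule always_eventually)
    moreover have "(\<lambda>n. \<delta> * (1 / 2) ^ n) \<longlonglongrightarrow> 0"
      by (intro tendsto_mult_right_zero LIMSEQ_power_zero) simp
    ultimately have "(\<lambda>n. iter_seq f r x0 n - r) \<longlonglongrightarrow> 0"
      by (rule Lim_null_comparison)
    then have "iter_seq f r x0 \<longlonglongrightarrow> r" by (simp add: LIM_zero_iff)
    moreover have "\<forall>n. \<bar>iter_seq f r x0 (Suc n) - r\<bar> \<le> C * \<bar>iter_seq f r x0 n - r\<bar> ^ p"
      using ord geo unfolding E_def by blast
    ultimately have "converges_with_order p (iter_seq f r x0) r"
      unfolding converges_with_order_def using C by blast
    moreover have "\<forall>n. \<bar>iter_seq f r x0 n - r\<bar> < \<delta>" using geo unfolding E_def by blast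
    ultimately show ?thesis by blast
  qed
  then show ?thesis using \<delta>(1,2) by (intro exI[of _ \<delta>]) simp
qed

theorem theorem1:
  fixes f :: "real \<Rightarrow> real" and D :: "real set" and r :: real
  assumes "open D" and "is_interval D"
    and "times_cont_diff_on 8 f D"
    and "r \<in> D" and "f r = 0" and "deriv f r \<noteq> 0"
  shows "\<exists>\<delta>>0. \<forall>x0. \<bar>x0 - r\<bar> < \<delta> \<longrightarrow>
           (\<forall>n. iter_seq f r x0 n \<noteq> r \<longrightarrow> step_defined f D (iter_seq f r x0 n)) \<and>
           converges_with_order 8 (iter_seq f r x0) r"
proof -
  have diff: "(deriv ^^ j) f field_differentiable at t" if "j < 8" "t \<in> D" for j t
    using assms(3) that by (auto simp: times_cont_diff_on_def)
  have "\<exists>b2 b3 K \<rho>. \<rho> > 0 \<and> (\<forall>t. \<bar>t - r\<bar> < \<rho> \<longrightarrow>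
      \<bar>deriv f t - (deriv f r + b2 * (t - r) + b3 * (t - r)\<^sup>2)\<bar> \<le> K * \<bar>t - r\<bar> ^ 3)"
  proof (rule quadratic_taylor_bound[OF assms(1,4)])
    show "(deriv ^^ j) (deriv f) field_differentiable at t" if "j < 4" "t \<in> D" for j t
      using diff[of "Suc j" t] that by (simp add: funpow_Suc_right del: funpow.simps)
  qed
  then obtain b2 b3 K \<rho>1 where jet: "\<rho>1 > 0" "\<And>t. \<bar>t - r\<bar> < \<rho>1 \<Longrightarrow>
      \<bar>deriv f t - (deriv f r + b2 * (t - r) + b3 * (t - r)\<^sup>2)\<bar> \<le> K * \<bar>t - r\<bar> ^ 3" by blast
  obtain \<rho>2 where \<rho>2: "\<rho>2 > 0" "\<And>t. \<bar>t - r\<bar> < \<rho>2 \<Longrightarrow> t \<in> D"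
    using assms(1,4) by (auto simp: open_dist dist_real_def)
  \<comment> \<open>integrating the expansion of \<open>f'\<close> gives the jet of \<open>f\<close>, hence the factors \<open>1 / 2\<close> and \<open>1 / 3\<close>\<close>
  interpret simple_zero_jet f r "deriv f r" "b2 / 2" "b3 / 3" K "min \<rho>1 \<rho>2"
  proof
    show "(f has_real_derivative deriv f t) (at t)" if "\<bar>t - r\<bar> < min \<rho>1 \<rho>2" for t
      using diff[of 0 t] \<rho>2(2)[of t] that by (simp add: field_differentiable_derivI)
  qed (use jet \<rho>2(1) assms(5,6) in auto)
  obtain C where C: "C > 0" "\<forall>\<^sub>F x in at r. norm (step_next f x - r) \<le> C * norm ((x - r) ^ 8)"
    using step_next_order unfolding vanish_def by (auto elim: landau_o.bigE)
  have "\<forall>\<^sub>F x in at r. step_defined f D x \<and> \<bar>step_next f x - r\<bar> \<le> C * \<bar>x - r\<bar> ^ 8"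
    using C(2) step_defined_near[OF assms(1,4)] by eventually_elim (simp add: power_abs)
  then obtain \<eta> where \<eta>: "\<eta> > 0" "\<And>x. x \<noteq> r \<Longrightarrow> \<bar>x - r\<bar> < \<eta> \<Longrightarrow>
      step_defined f D x \<and> \<bar>step_next f x - r\<bar> \<le> C * \<bar>x - r\<bar> ^ 8"
    by (auto simp: eventually_at dist_real_def)
  obtain \<delta> where \<delta>: "0 < \<delta>" "\<delta> \<le> \<eta>" "\<And>x0. \<bar>x0 - r\<bar> < \<delta> \<Longrightarrow>
      (\<forall>n. \<bar>iter_seq f r x0 n - r\<bar> < \<delta>) \<and> converges_with_order 8 (iter_seq f r x0) r"
    using iter_seq_converges_with_order[of 8 C \<eta> r f] C(1) \<eta> by auto
  have "step_defined f D (iter_seq f r x0 n)"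
    if "\<bar>x0 - r\<bar> < \<delta>" "iter_seq f r x0 n \<noteq> r" for x0 n
    using \<delta>(2) \<delta>(3)[OF that(1)] \<eta>(2)[OF that(2)] by (meson less_le_trans)
  with \<delta>(1,3) show ?thesis by blast
qed

end
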